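(* Let $1\le t\le n$ be integers, let $f:\{0,1\}^n\to\{0,1\}$ be either constant or balanced, and for $w\in\{0,1\}^t$ let $f_w:\{0,1\}^{n-t}\to\{0,1\}$, $f_w(u)=f(uw)$. Consider the following procedure on $n+2^t+3$ qubits, arranged as: a control register of $n-t$ qubits; $2^t$ single qubits $q_w$ indexed by $w\in\{0,1\}^t$; a register $D$ of $t+2$ qubits; and a last single qubit. It queries each oracle $O_{f_w}$ exactly twice. 1. Prepare the all-zero state and apply $H^{\otimes(n-t)}$ to the control register. 2. For each $w\in\{0,1\}^t$ apply $O_{f_w}$ to the control register and $q_w$. 3. Apply $U$ to the qubits $(q_w)_{w}$ and $D$. 4. Apply $R$ to $D$ and the last qubit. 5. Apply $U$ to the qubits $(q_w)_w$ and $D$, and then, for each $w\in\{0,1\}^t$, apply $O_{f_w}$ to the control register and $q_w$. 6. Measure the last qubit in the computational basis. If the result is $1$, output "balanced" and stop. 7. If the result is $0$, apply $H^{\otimes (n-t)}$ to the control register of the post-measurement state and measure the control register in the computational basis. If the result is $0^{n-t}$, output "constant"; otherwise output "balanced". Then the procedure is exact: with probability $1$ it outputs "constant" if $f$ is constant, and with probability $1$ it outputs "balanced" if $f$ is balanced.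
   Context: A Boolean function $f:\{0,1\}^n\to\{0,1\}$ is constant if $f\equiv 0$ or $f\equiv 1$, and balanced if $|\{x: f(x)=0\}|=|\{x: f(x)=1\}|=2^{n-1}$. For bit strings $u,w$, $uw$ denotes concatenation. $H$ is the one-qubit Hadamard gate, $H|b\rangle=\frac{1}{\sqrt2}(|0\rangle+(-1)^b|1\rangle)$. The oracle $O_{f_w}$ is the unitary $O_{f_w}|u\rangle|c\rangle=|u\rangle|c\oplus f_w(u)\rangle$ for $u\in\{0,1\}^{n-t}$, $c\in\{0,1\}$. Integers in $[-2^{t+1},2^{t+1}-1]$ are identified with bit strings in $\{0,1\}^{t+2}$ by two's complement (so $0$ is the zero string), and $\oplus$ on strings is bitwise XOR. The unitary $U$ acts on $2^t$ qubits and a $(t+2)$-qubit register by $$U\Big(\bigotimes_{i\in\{0,1\}^t}|a_i\rangle\Big)|b\rangle=\Big(\bigotimes_{i\in\{0,1\}^t}|a_i\rangle\Big)\Big|b\oplus\Big(2^t-2\sum_{i\in\{0,1\}^t}a_i\Big)\Big\rangle ,\quad a_i\in\{0,1\},\ b\in\{0,1\}^{t+2}.$$ $R$ is a unitary on a $(t+2)$-qubit register and one qubit such that, for every integer $d$ with $|d|\le 2^t$ and every $e\in\{0,1\}$, $$R|d\rangle|e\rangle=|d\rangle\Big(\frac{d}{2^t}|e\rangle+(-1)^e\sqrt{1-\Big(\frac{d}{2^t}\Big)^2}\,|1\oplus e\rangle\Big)$$ (its action on $|d\rangle|e\rangle$ with $|d|>2^t$ is arbitrary). *)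

theory Defs
  imports "HOL-Probability.Probability_Mass_Function" "HOL-Library.FuncSet"
begin

section \<open>Boolean functions and bit strings\<close>

definition bitstrings :: "nat \<Rightarrow> bool list set" where
  "bitstrings m = {x. length x = m}"

definition constant_fun :: "nat \<Rightarrow> (bool list \<Rightarrow> bool) \<Rightarrow> bool" where
  "constant_fun n f \<longleftrightarrow> (\<forall>x\<in>bitstrings n. f x = False) \<or> (\<forall>x\<in>bitstrings n. f x = True)"

definition balanced_fun :: "nat \<Rightarrow> (bool list \<Rightarrow> bool) \<Rightarrow> bool" where
  "balanced_fun n f \<longleftrightarrow>
     card {x \<in> bitstrings n. f x = False} = 2 ^ (n - 1) \<and>
     card {x \<in> bitstrings n. f x = True} = 2 ^ (n - 1)"

definition subfun :: "(bool list \<Rightarrow> bool) \<Rightarrow> bool list \<Rightarrow> bool list \<Rightarrow> bool" where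
  "subfun f w = (\<lambda>u. f (u @ w))"

definition xor_bits :: "bool list \<Rightarrow> bool list \<Rightarrow> bool list" where
  "xor_bits b c = map2 (\<noteq>) b c"

text \<open>
  Two's complement with \<open>m\<close> bits, most significant bit first. On integers, \<^const>\<open>bit\<close> reads
  the infinite two's complement expansion, so this is the usual encoding of
  \<open>- 2 ^ (m - 1) \<le> k < 2 ^ (m - 1)\<close>.
\<close>
definition int_bits :: "nat \<Rightarrow> int \<Rightarrow> bool list" where
  "int_bits m k = map (bit k) (rev [0..<m])"

section \<open>States, operators and measurements\<close>

text \<open>
  A finite-dimensional Hilbert space is given by the finite set \<open>B\<close> of labels of its computational
  basis. A vector is its amplitude function, and an operator its matrix, with \<open>A x y\<close> the entry in
  row \<open>x\<close> and column \<open>y\<close>; only labels in \<open>B\<close> matter.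
\<close>

type_synonym 'b state = "'b \<Rightarrow> complex"
type_synonym 'b operator = "'b \<Rightarrow> 'b \<Rightarrow> complex"

definition ket :: "'b \<Rightarrow> 'b state" where
  "ket b = (\<lambda>x. of_bool (x = b))"

definition apply_op :: "'b set \<Rightarrow> 'b operator \<Rightarrow> 'b state \<Rightarrow> 'b state" where
  "apply_op B A \<psi> = (\<lambda>x. if x \<in> B then \<Sum>y\<in>B. A x y * \<psi> y else 0)"

definition unitary_on :: "'b set \<Rightarrow> 'b operator \<Rightarrow> bool" where
  "unitary_on B A \<longleftrightarrow>
     (\<forall>x\<in>B. \<forall>y\<in>B. (\<Sum>z\<in>B. cnj (A z x) * A z y) = of_bool (x = y)) \<and>
     (\<forall>x\<in>B. \<forall>y\<in>B. (\<Sum>z\<in>B. A x z * cnj (A y z)) = of_bool (x = y))"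

text \<open>The operator \<open>|y\<rangle> \<mapsto> |g y\<rangle>\<close>.\<close>
definition basis_map_op :: "('b \<Rightarrow> 'b) \<Rightarrow> 'b operator" where
  "basis_map_op g = (\<lambda>x y. of_bool (x = g y))"

text \<open>
  The operator \<open>A\<close> on one tensor factor, extended by the identity on the other one. The
  factorisation is described by the parts \<open>reg x\<close> and \<open>rest x\<close> of a basis label \<open>x\<close>.
\<close>
definition on_register :: "('b \<Rightarrow> 'r) \<Rightarrow> ('b \<Rightarrow> 's) \<Rightarrow> 'r operator \<Rightarrow> 'b operator" where
  "on_register reg rest A = (\<lambda>x y. A (reg x) (reg y) * of_bool (rest x = rest y))"

text \<open>
  Computational-basis measurement of the register \<open>q\<close>: the Born weight of outcome \<open>r\<close>, the
  normalised post-measurement state, and the resulting joint distribution. The function passed to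
  \<^const>\<open>embed_pmf\<close> sums to 1 exactly when \<open>\<psi>\<close> is a unit vector.
\<close>
definition born_weight :: "'b set \<Rightarrow> ('b \<Rightarrow> 'r) \<Rightarrow> 'b state \<Rightarrow> 'r \<Rightarrow> real" where
  "born_weight B q \<psi> r = (\<Sum>x\<in>{x \<in> B. q x = r}. (cmod (\<psi> x))\<^sup>2)"

definition post_state :: "'b set \<Rightarrow> ('b \<Rightarrow> 'r) \<Rightarrow> 'b state \<Rightarrow> 'r \<Rightarrow> 'b state" where
  "post_state B q \<psi> r =
     (\<lambda>x. if q x = r then \<psi> x / complex_of_real (sqrt (born_weight B q \<psi> r)) else 0)"

definition measure_register ::
  "'b set \<Rightarrow> ('b \<Rightarrow> 'r) \<Rightarrow> 'b state \<Rightarrow> ('r \<times> 'b state) pmf" where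
  "measure_register B q \<psi> =
     map_pmf (\<lambda>r. (r, post_state B q \<psi> r)) (embed_pmf (born_weight B q \<psi>))"

section \<open>The gates\<close>

definition hadamard :: "bool operator" where
  "hadamard = (\<lambda>c b. (if c then (- 1) ^ of_bool b else 1) / complex_of_real (sqrt 2))"

definition hadamard_n :: "nat \<Rightarrow> bool list operator" where
  "hadamard_n m = (\<lambda>v u. \<Prod>i<m. hadamard (v ! i) (u ! i))"

definition oracle_op :: "(bool list \<Rightarrow> bool) \<Rightarrow> (bool list \<times> bool) operator" where
  "oracle_op g = basis_map_op (\<lambda>(u, c). (u, c \<noteq> g u))"

definition U_op :: "nat \<Rightarrow> ((bool list \<Rightarrow> bool) \<times> bool list) operator" where
  "U_op t = basis_map_op (\<lambda>(a, b).
     (a, xor_bits b (int_bits (t + 2) (2 ^ t - 2 * (\<Sum>i\<in>bitstrings t. of_bool (a i))))))"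

definition R_basis :: "nat \<Rightarrow> (bool list \<times> bool) set" where
  "R_basis t = bitstrings (t + 2) \<times> UNIV"

definition is_R :: "nat \<Rightarrow> (bool list \<times> bool) operator \<Rightarrow> bool" where
  "is_R t R \<longleftrightarrow>
     unitary_on (R_basis t) R \<and>
     (\<forall>d::int. \<forall>e. \<bar>d\<bar> \<le> 2 ^ t \<longrightarrow>
        apply_op (R_basis t) R (ket (int_bits (t + 2) d, e)) =
        (\<lambda>x. complex_of_real (real_of_int d / 2 ^ t) * ket (int_bits (t + 2) d, e) x
           + (- 1) ^ of_bool e * complex_of_real (sqrt (1 - (real_of_int d / 2 ^ t)\<^sup>2))
               * ket (int_bits (t + 2) d, \<not> e) x))"

section \<open>The procedure\<close>

text \<open>
  A basis label \<open>(u, a, d, e)\<close> of the whole system consists of the control register \<open>u\<close>, the qubits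
  \<open>a w\<close> for \<open>w \<in> bitstrings t\<close>, the register \<open>d\<close> (called \<open>D\<close> informally) and the last qubit \<open>e\<close>.
\<close>
type_synonym label = "bool list \<times> (bool list \<Rightarrow> bool) \<times> bool list \<times> bool"

definition sys_basis :: "nat \<Rightarrow> nat \<Rightarrow> label set" where
  "sys_basis n t =
     bitstrings (n - t) \<times> (bitstrings t \<rightarrow>\<^sub>E UNIV) \<times> bitstrings (t + 2) \<times> UNIV"

definition zero_label :: "nat \<Rightarrow> nat \<Rightarrow> label" where
  "zero_label n t =
     (replicate (n - t) False, \<lambda>w\<in>bitstrings t. False, replicate (t + 2) False, False)"

definition control :: "label \<Rightarrow> bool list" where
  "control = (\<lambda>(u, a, d, e). u)"

definition last_qubit :: "label \<Rightarrow> bool" where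
  "last_qubit = (\<lambda>(u, a, d, e). e)"

datatype gate = Hadamard_Control | Query "bool list" | Gate_U | Gate_R

primrec gate_op ::
  "nat \<Rightarrow> nat \<Rightarrow> (bool list \<Rightarrow> bool) \<Rightarrow> (bool list \<times> bool) operator \<Rightarrow> gate \<Rightarrow> label operator" where
  "gate_op n t f R Hadamard_Control =
     on_register control (\<lambda>(u, a, d, e). (a, d, e)) (hadamard_n (n - t))"
| "gate_op n t f R (Query w) =
     on_register (\<lambda>(u, a, d, e). (u, a w)) (\<lambda>(u, a, d, e). (a(w := undefined), d, e))
       (oracle_op (subfun f w))"
| "gate_op n t f R Gate_U =
     on_register (\<lambda>(u, a, d, e). (a, d)) (\<lambda>(u, a, d, e). (u, e)) (U_op t)"
| "gate_op n t f R Gate_R =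
     on_register (\<lambda>(u, a, d, e). (d, e)) (\<lambda>(u, a, d, e). (u, a)) R"

definition run_gates ::
  "nat \<Rightarrow> nat \<Rightarrow> (bool list \<Rightarrow> bool) \<Rightarrow> (bool list \<times> bool) operator \<Rightarrow> gate list
     \<Rightarrow> label state \<Rightarrow> label state" where
  "run_gates n t f R gs = fold (\<lambda>g. apply_op (sys_basis n t) (gate_op n t f R g)) gs"

text \<open>
  The lists \<open>ws\<close> and \<open>ws'\<close> are the orders in which the oracles are applied the first and the
  second time.
\<close>
definition main_gates :: "bool list list \<Rightarrow> bool list list \<Rightarrow> gate list" where
  "main_gates ws ws' =
     [Hadamard_Control] @ map Query ws @ [Gate_U, Gate_R, Gate_U] @ map Query ws'"

definition final_gates :: "gate list" where
  "final_gates = [Hadamard_Control]"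

datatype verdict = Says_Constant | Says_Balanced

definition procedure ::
  "nat \<Rightarrow> nat \<Rightarrow> (bool list \<Rightarrow> bool) \<Rightarrow> (bool list \<times> bool) operator
     \<Rightarrow> bool list list \<Rightarrow> bool list list \<Rightarrow> verdict pmf" where
  "procedure n t f R ws ws' =
     bind_pmf
       (measure_register (sys_basis n t) last_qubit
          (run_gates n t f R (main_gates ws ws') (ket (zero_label n t))))
       (\<lambda>(r, \<psi>).
          if r then return_pmf Says_Balanced
          else
            map_pmf
              (\<lambda>(u, _). if u = replicate (n - t) False then Says_Constant else Says_Balanced)
              (measure_register (sys_basis n t) control (run_gates n t f R final_gates \<psi>)))"

end

theory Submission imports Defs begin

text \<open>
  Let \<open>d(u) = 2 ^ t - 2 * \<Sum>w. f(uw)\<close>. Computing and uncomputing the values \<open>f(uw)\<close> and \<open>d(u)\<close> around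
  \<open>R\<close> multiplies the branch \<open>u\<close> of the uniform superposition by \<open>d(u) / 2 ^ t\<close> on \<open>|0\<rangle>\<close> of the last
  qubit. If \<open>f\<close> is constant then \<open>d(u) = \<plusminus>2 ^ t\<close> with a sign not depending on \<open>u\<close>, so outcome 1 is
  impossible and the Hadamard transform returns the control register to zero. If \<open>f\<close> is balanced,
  the amplitude of the zero string after the transform is proportional to \<open>\<Sum>u. d(u) = 0\<close>.
\<close>

section \<open>Bit strings\<close>

lemma bitstrings_lists: "bitstrings m = {xs. set xs \<subseteq> UNIV \<and> length xs = m}"
  by (simp add: bitstrings_def)

lemma finite_bitstrings [simp]: "finite (bitstrings m)"
  unfolding bitstrings_lists by (rule finite_lists_length_eq) simp

lemma card_bitstrings [simp]: "card (bitstrings m) = 2 ^ m"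
  unfolding bitstrings_lists by (subst card_lists_length_eq) simp_all

lemma replicate_in_bitstrings [simp]: "replicate m b \<in> bitstrings m"
  by (simp add: bitstrings_def)

lemma int_bits_in_bitstrings [simp]: "int_bits m k \<in> bitstrings m"
  by (simp add: bitstrings_def int_bits_def)

lemma xor_bits_in_bitstrings [simp]:
  "b \<in> bitstrings m \<Longrightarrow> c \<in> bitstrings m \<Longrightarrow> xor_bits b c \<in> bitstrings m"
  by (simp add: bitstrings_def xor_bits_def)

lemma xor_bits_zero: "c \<in> bitstrings m \<Longrightarrow> xor_bits (replicate m False) c = c"
  by (auto simp: bitstrings_def xor_bits_def intro!: nth_equalityI)

lemma xor_bits_self: "c \<in> bitstrings m \<Longrightarrow> xor_bits c c = replicate m False"
  by (auto simp: bitstrings_def xor_bits_def intro!: nth_equalityI)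

lemma sum_bitstrings_Suc:
  "(\<Sum>v\<in>bitstrings (Suc m). h v) = (\<Sum>b\<in>UNIV. \<Sum>v\<in>bitstrings m. h (b # v))"
proof -
  have "(\<Sum>v\<in>bitstrings (Suc m). h v) = (\<Sum>(b, v)\<in>UNIV \<times> bitstrings m. h (b # v))"
    by (rule sum.reindex_bij_witness[where i = "\<lambda>(b, v). b # v" and j = "\<lambda>v. (hd v, tl v)"])
      (auto simp: bitstrings_def length_Suc_conv)
  then show ?thesis by (simp add: sum.cartesian_product)
qed

lemma sum_bitstrings_append:
  assumes "t \<le> n"
  shows "(\<Sum>u\<in>bitstrings (n - t). \<Sum>w\<in>bitstrings t. h (u @ w)) = (\<Sum>x\<in>bitstrings n. h x)"
proof -
  have "(\<Sum>x\<in>bitstrings n. h x) = (\<Sum>(u, w)\<in>bitstrings (n - t) \<times> bitstrings t. h (u @ w))"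
    by (rule sum.reindex_bij_witness[where i = "\<lambda>(u, w). u @ w"
          and j = "\<lambda>x. (take (n - t) x, drop (n - t) x)"])
      (use assms in \<open>auto simp: bitstrings_def\<close>)
  then show ?thesis by (simp add: sum.cartesian_product)
qed

section \<open>Superpositions of basis states\<close>

text \<open>States are carried as families of branches, so that a gate acts by relabelling branches
  or by splitting them. The labels \<open>g i\<close> may coincide; their amplitudes then add, which
  is interference.\<close>

definition superpos :: "'i set \<Rightarrow> ('i \<Rightarrow> complex) \<Rightarrow> ('i \<Rightarrow> 'b) \<Rightarrow> 'b state" where
  "superpos I c g = (\<lambda>x. \<Sum>i\<in>I. c i * ket (g i) x)"

lemma superpos_eval: "finite I \<Longrightarrow> inj_on g I \<Longrightarrow> i \<in> I \<Longrightarrow> superpos I c g (g i) = c i"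
  unfolding superpos_def ket_def
  by (subst sum.remove[of I i]) (auto simp: inj_on_def intro!: sum.neutral)

lemma superpos_outside: "x \<notin> g ` I \<Longrightarrow> superpos I c g x = 0"
  unfolding superpos_def ket_def by (auto intro!: sum.neutral)

lemma apply_op_sum:
  "apply_op B A (\<lambda>x. \<Sum>i\<in>I. c i * \<psi> i x) = (\<lambda>x. \<Sum>i\<in>I. c i * apply_op B A (\<psi> i) x)"
proof
  fix x
  have "(\<Sum>y\<in>B. A x y * (\<Sum>i\<in>I. c i * \<psi> i y)) = (\<Sum>y\<in>B. \<Sum>i\<in>I. c i * (A x y * \<psi> i y))"
    by (simp add: sum_distrib_left mult_ac)
  also have "\<dots> = (\<Sum>i\<in>I. \<Sum>y\<in>B. c i * (A x y * \<psi> i y))"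
    by (rule sum.swap)
  finally show "apply_op B A (\<lambda>x. \<Sum>i\<in>I. c i * \<psi> i x) x = (\<Sum>i\<in>I. c i * apply_op B A (\<psi> i) x)"
    by (simp add: apply_op_def sum_distrib_left)
qed

lemma run_gates_Nil: "run_gates n t f R [] \<psi> = \<psi>"
  by (simp add: run_gates_def)

lemma run_gates_Cons:
  "run_gates n t f R (g # gs) \<psi> =
     run_gates n t f R gs (apply_op (sys_basis n t) (gate_op n t f R g) \<psi>)"
  by (simp add: run_gates_def)

lemma run_gates_append:
  "run_gates n t f R (gs @ gs') \<psi> = run_gates n t f R gs' (run_gates n t f R gs \<psi>)"
  by (simp add: run_gates_def)

lemma run_gates_sum:
  "run_gates n t f R gs (\<lambda>x. \<Sum>i\<in>I. c i * \<psi> i x) = (\<lambda>x. \<Sum>i\<in>I. c i * run_gates n t f R gs (\<psi> i) x)"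
  by (induction gs arbitrary: \<psi>) (simp_all add: run_gates_Nil run_gates_Cons apply_op_sum)

text \<open>By linearity each branch \<open>i\<close> splits into branches indexed by
  \<open>J\<close>. The pairs are kept as indices even where labels coincide, so no amplitudes are
  merged here.\<close>

lemma run_gates_superpos:
  assumes "\<And>i. i \<in> I \<Longrightarrow> run_gates n t f R gs (ket (g i)) = superpos J (k i) (h i)"
  shows "run_gates n t f R gs (superpos I c g) =
           superpos (I \<times> J) (\<lambda>(i, j). c i * k i j) (\<lambda>(i, j). h i j)"
proof -
  have "run_gates n t f R gs (superpos I c g) = (\<lambda>x. \<Sum>i\<in>I. c i * superpos J (k i) (h i) x)"
    unfolding superpos_def[of I] run_gates_sum using assms by (intro ext sum.cong) auto
  also have "\<dots> = superpos (I \<times> J) (\<lambda>(i, j). c i * k i j) (\<lambda>(i, j). h i j)"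
    by (simp add: superpos_def sum_distrib_left sum.cartesian_product case_prod_beta mult.assoc)
  finally show ?thesis .
qed

lemma run_gates_superpos_ket:
  assumes "\<And>i. i \<in> I \<Longrightarrow> run_gates n t f R gs (ket (g i)) = ket (h i)"
  shows "run_gates n t f R gs (superpos I c g) = superpos I c h"
  unfolding superpos_def run_gates_sum using assms by (intro ext sum.cong) auto

section \<open>Measuring a superposition\<close>

lemma set_measure_register:
  assumes B: "finite B" and unit: "(\<Sum>x\<in>B. (cmod (\<psi> x))\<^sup>2) = 1"
  shows "set_pmf (measure_register B q \<psi>) =
           (\<lambda>r. (r, post_state B q \<psi> r)) ` {r. born_weight B q \<psi> r \<noteq> 0}"
proof -
  have nonneg: "0 \<le> born_weight B q \<psi> r" for r
    by (simp add: born_weight_def sum_nonneg)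
  have "(\<integral>\<^sup>+ r. ennreal (born_weight B q \<psi> r) \<partial>count_space UNIV) =
      (\<Sum>r\<in>q ` B. ennreal (born_weight B q \<psi> r))"
  proof (rule nn_integral_count_space')
    fix r assume "r \<notin> q ` B"
    then have empty: "{x \<in> B. q x = r} = {}" by auto
    show "ennreal (born_weight B q \<psi> r) = 0" unfolding born_weight_def empty by simp
  qed (use B in auto)
  also have "\<dots> = ennreal (\<Sum>r\<in>q ` B. born_weight B q \<psi> r)"
    by (simp add: nonneg)
  also have "(\<Sum>r\<in>q ` B. born_weight B q \<psi> r) = 1"
    using sum.image_gen[OF B, of "\<lambda>x. (cmod (\<psi> x))\<^sup>2" q] unit by (simp add: born_weight_def)
  finally have "set_pmf (embed_pmf (born_weight B q \<psi>)) = {r. born_weight B q \<psi> r \<noteq> 0}"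
    using nonneg by (intro set_embed_pmf) auto
  then show ?thesis by (simp add: measure_register_def)
qed

text \<open>Injectivity of \<open>g\<close> excludes interference, so squared moduli can be added
  branch by branch.\<close>

lemma born_weight_superpos:
  assumes "finite B" "inj_on g I" "g ` I \<subseteq> B"
  shows "born_weight B q (superpos I c g) r = (\<Sum>i\<in>{i \<in> I. q (g i) = r}. (cmod (c i))\<^sup>2)"
proof -
  have I: "finite I" using assms by (meson finite_imageD finite_subset)
  have "born_weight B q (superpos I c g) r =
      (\<Sum>x\<in>g ` {i \<in> I. q (g i) = r}. (cmod (superpos I c g x))\<^sup>2)"
    unfolding born_weight_def
    by (rule sum.mono_neutral_right) (use assms in \<open>auto intro!: superpos_outside\<close>)
  also have "\<dots> = (\<Sum>i\<in>{i \<in> I. q (g i) = r}. (cmod (superpos I c g (g i)))\<^sup>2)"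
    using assms by (subst sum.reindex) (auto simp: inj_on_def)
  also have "\<dots> = (\<Sum>i\<in>{i \<in> I. q (g i) = r}. (cmod (c i))\<^sup>2)"
    using superpos_eval[OF I assms(2)] by (intro sum.cong) auto
  finally show ?thesis .
qed

lemma norm_superpos:
  assumes "finite B" "inj_on g I" "g ` I \<subseteq> B"
  shows "(\<Sum>x\<in>B. (cmod (superpos I c g x))\<^sup>2) = (\<Sum>i\<in>I. (cmod (c i))\<^sup>2)"
  \<comment> \<open>The squared norm is the Born weight of the only outcome of a trivial
    register.\<close>
  using born_weight_superpos[OF assms, of "\<lambda>_. ()" c "()"] by (simp add: born_weight_def)

text \<open>The term of index \<open>i\<close> can be nonzero at \<open>x\<close> only if
  \<open>x = g i\<close>, so selecting labels by \<open>q x = r\<close> amounts to selecting indices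
  by \<open>q (g i) = r\<close>.\<close>

lemma post_state_superpos:
  assumes "finite I"
  shows "post_state B q (superpos I c g) r =
           superpos {i \<in> I. q (g i) = r}
             (\<lambda>i. c i / complex_of_real (sqrt (born_weight B q (superpos I c g) r))) g"
proof
  fix x
  define s where "s = complex_of_real (sqrt (born_weight B q (superpos I c g) r))"
  have "superpos {i \<in> I. q (g i) = r} (\<lambda>i. c i / s) g x =
      (\<Sum>i\<in>I. if q (g i) = r then c i / s * ket (g i) x else 0)"
    unfolding superpos_def using assms by (rule sum.inter_filter)
  also have "\<dots> = (\<Sum>i\<in>I. if q x = r then c i * ket (g i) x / s else 0)"
    by (intro sum.cong) (auto simp: ket_def)
  also have "\<dots> = (if q x = r then superpos I c g x / s else 0)"
    by (simp add: superpos_def sum_divide_distrib)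
  finally show "post_state B q (superpos I c g) r x = superpos {i \<in> I. q (g i) = r}
      (\<lambda>i. c i / complex_of_real (sqrt (born_weight B q (superpos I c g) r))) g x"
    by (simp add: post_state_def s_def)
qed

section \<open>The Hadamard transform\<close>

lemma hadamard_n_Cons:
  "hadamard_n (Suc m) (b # v) (c # u) = hadamard b c * hadamard_n m v u"
  unfolding hadamard_n_def by (subst prod.lessThan_Suc_shift) simp

lemma hadamard_orthonormal:
  "(\<Sum>b\<in>UNIV. cnj (hadamard b c) * hadamard b c') = of_bool (c = c')"
  by (cases c; cases c') (simp_all add: hadamard_def UNIV_bool field_simps flip: of_real_mult)

text \<open>Splitting off the first bit factors the inner product of two columns into a one-qubit
  inner product and one for the remaining bits.\<close>

lemma hadamard_n_orthonormal:
  assumes "u \<in> bitstrings m" "u' \<in> bitstrings m"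
  shows "(\<Sum>v\<in>bitstrings m. cnj (hadamard_n m v u) * hadamard_n m v u') = of_bool (u = u')"
  using assms
proof (induction m arbitrary: u u')
  case 0
  then show ?case by (simp add: bitstrings_def hadamard_n_def)
next
  case (Suc m)
  then obtain c y c' y' where u: "u = c # y" "u' = c' # y'" "y \<in> bitstrings m" "y' \<in> bitstrings m"
    by (auto simp: bitstrings_def length_Suc_conv)
  have "(\<Sum>v\<in>bitstrings (Suc m). cnj (hadamard_n (Suc m) v u) * hadamard_n (Suc m) v u') =
      (\<Sum>b\<in>UNIV. \<Sum>v\<in>bitstrings m. (cnj (hadamard b c) * hadamard b c') *
         (cnj (hadamard_n m v y) * hadamard_n m v y'))"
    by (simp only: sum_bitstrings_Suc u hadamard_n_Cons complex_cnj_mult mult_ac)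
  also have "\<dots> = (\<Sum>b\<in>UNIV. cnj (hadamard b c) * hadamard b c') *
      (\<Sum>v\<in>bitstrings m. cnj (hadamard_n m v y) * hadamard_n m v y')"
    by (rule sum_product[symmetric])
  finally show ?case
    using Suc.IH[OF u(3,4)] u by (simp add: hadamard_orthonormal)
qed

text \<open>Parseval's identity: the squared modulus is expanded into a double sum over
  \<open>u\<close> and \<open>u'\<close>, the sum over \<open>v\<close> is moved innermost, and
  orthonormality of the columns leaves the diagonal.\<close>

lemma hadamard_n_norm:
  "(\<Sum>v\<in>bitstrings m. (cmod (\<Sum>u\<in>bitstrings m. c u * hadamard_n m v u))\<^sup>2) =
     (\<Sum>u\<in>bitstrings m. (cmod (c u))\<^sup>2)"
proof -
  let ?I = "bitstrings m"
  have sq: "complex_of_real ((cmod z)\<^sup>2) = cnj z * z" for z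
    by (simp only: complex_norm_square mult.commute)
  have "complex_of_real (\<Sum>v\<in>?I. (cmod (\<Sum>u\<in>?I. c u * hadamard_n m v u))\<^sup>2) =
      (\<Sum>v\<in>?I. \<Sum>u\<in>?I. \<Sum>u'\<in>?I.
         cnj (c u) * c u' * (cnj (hadamard_n m v u) * hadamard_n m v u'))"
    unfolding of_real_sum sq cnj_sum complex_cnj_mult sum_product by (simp only: mult_ac)
  also have "\<dots> = (\<Sum>u\<in>?I. \<Sum>v\<in>?I. \<Sum>u'\<in>?I.
         cnj (c u) * c u' * (cnj (hadamard_n m v u) * hadamard_n m v u'))"
    by (rule sum.swap)
  also have "\<dots> = (\<Sum>u\<in>?I. \<Sum>u'\<in>?I. \<Sum>v\<in>?I.
         cnj (c u) * c u' * (cnj (hadamard_n m v u) * hadamard_n m v u'))"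
    by (intro sum.cong refl sum.swap)
  also have "\<dots> = (\<Sum>u\<in>?I. \<Sum>u'\<in>?I. cnj (c u) * c u' * of_bool (u = u'))"
    by (intro sum.cong refl) (simp only: hadamard_n_orthonormal flip: sum_distrib_left)
  also have "\<dots> = complex_of_real (\<Sum>u\<in>?I. (cmod (c u))\<^sup>2)"
    unfolding of_real_sum sq by (intro sum.cong refl) (simp add: of_bool_def if_distrib cong: if_cong)
  finally show ?thesis by (simp only: of_real_eq_iff)
qed

lemma hadamard_n_zero_right:
  assumes "v \<in> bitstrings m"
  shows "hadamard_n m v (replicate m False) = complex_of_real (1 / sqrt (2 ^ m))"
proof -
  have "hadamard_n m v (replicate m False) = (\<Prod>i<m. 1 / complex_of_real (sqrt 2))"
    unfolding hadamard_n_def by (intro prod.cong) (simp_all add: hadamard_def)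
  then show ?thesis by (simp add: real_sqrt_power power_divide)
qed

text \<open>Every one-qubit factor is real and symmetric. This transfers facts about columns to
  rows, in particular the constant entries of the zero column.\<close>

lemma hadamard_n_hermitian: "hadamard_n m v u = cnj (hadamard_n m u v)"
  unfolding hadamard_n_def cnj_prod
  by (intro prod.cong refl) (auto simp: hadamard_def)

section \<open>The gates on basis states\<close>

lemma finite_sys_basis [simp]: "finite (sys_basis n t)"
  by (simp add: sys_basis_def finite_PiE)

lemma apply_op_ket:
  assumes "finite B" "y \<in> B"
  shows "apply_op B A (ket y) = (\<lambda>x. if x \<in> B then A x y else 0)"
  using assms by (auto simp: apply_op_def ket_def of_bool_def if_distrib cong: if_cong)

text \<open>In the column of \<open>y\<close> only labels with register part
  \<open>g (reg y)\<close> and remaining part \<open>rest y\<close> have a nonzero entry. The two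
  parts together determine the label, so \<open>y'\<close> is the only one.\<close>

lemma apply_on_register_basis_map:
  assumes "finite B" "y \<in> B" "y' \<in> B"
    and "reg y' = g (reg y)" "rest y' = rest y"
    and inj: "\<And>x. reg x = reg y' \<Longrightarrow> rest x = rest y' \<Longrightarrow> x = y'"
  shows "apply_op B (on_register reg rest (basis_map_op g)) (ket y) = ket y'"
proof
  fix x
  have "reg x = g (reg y) \<and> rest x = rest y \<longleftrightarrow> x = y'"
    unfolding assms(4,5)[symmetric] using inj by blast
  with assms(3) show "apply_op B (on_register reg rest (basis_map_op g)) (ket y) x = ket y' x"
    unfolding apply_op_ket[OF assms(1,2)]
    by (cases "x = y'") (simp_all add: on_register_def basis_map_op_def ket_def flip: of_bool_conj)
qed

lemma apply_Query:
  assumes "(u, a, d, e) \<in> sys_basis n t" "w \<in> bitstrings t"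
  shows "apply_op (sys_basis n t) (gate_op n t f R (Query w)) (ket (u, a, d, e)) =
           ket (u, a(w := (a w \<noteq> f (u @ w))), d, e)"
  unfolding gate_op.simps oracle_op_def
proof (rule apply_on_register_basis_map)
  show "(u, a(w := (a w \<noteq> f (u @ w))), d, e) \<in> sys_basis n t"
    using assms by (auto simp: sys_basis_def PiE_def extensional_def)
  fix x :: label
  assume reg: "(\<lambda>(u, a, d, e). (u, a w)) x =
      (\<lambda>(u, a, d, e). (u, a w)) (u, a(w := (a w \<noteq> f (u @ w))), d, e)"
    and rest: "(\<lambda>(u, a, d, e). (a(w := undefined), d, e)) x =
      (\<lambda>(u, a, d, e). (a(w := undefined), d, e)) (u, a(w := (a w \<noteq> f (u @ w))), d, e)"
  obtain u' a' d' e' where x: "x = (u', a', d', e')" by (cases x)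
  have eqs: "u' = u" "a' w = (a w \<noteq> f (u @ w))" "a'(w := undefined) = a(w := undefined)"
      "d' = d" "e' = e"
    using reg rest unfolding x by simp_all
  \<comment> \<open>The remaining part hides only the value at \<open>w\<close>, and the register
    part supplies exactly that value.\<close>
  have "a' = (a'(w := undefined))(w := a' w)" by simp
  also have "\<dots> = a(w := (a w \<noteq> f (u @ w)))" unfolding eqs(2,3) by simp
  finally show "x = (u, a(w := (a w \<noteq> f (u @ w))), d, e)"
    unfolding x eqs(1,4,5) by simp
qed (simp_all add: assms subfun_def)

lemma run_Queries:
  assumes "(u, a, d, e) \<in> sys_basis n t" "set ws \<subseteq> bitstrings t" "distinct ws"
  shows "run_gates n t f R (map Query ws) (ket (u, a, d, e)) =
           ket (u, \<lambda>w. if w \<in> set ws then a w \<noteq> f (u @ w) else a w, d, e)"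
  using assms
proof (induction ws arbitrary: a)
  case Nil
  then show ?case by (simp add: run_gates_Nil)
next
  case (Cons w ws)
  let ?a = "a(w := (a w \<noteq> f (u @ w)))"
  have mem: "(u, ?a, d, e) \<in> sys_basis n t"
    using Cons.prems by (auto simp: sys_basis_def PiE_def extensional_def)
  have w: "w \<in> bitstrings t" and ws: "set ws \<subseteq> bitstrings t" "distinct ws"
    using Cons.prems by auto
  \<comment> \<open>Distinctness matters: \<open>w\<close> does not occur in \<open>ws\<close>, so
    no later query undoes the flip at \<open>w\<close>.\<close>
  have "(\<lambda>v. if v \<in> set ws then ?a v \<noteq> f (u @ v) else ?a v) =
      (\<lambda>v. if v \<in> set (w # ws) then a v \<noteq> f (u @ v) else a v)"
    using Cons.prems by auto
  then show ?case
    unfolding list.map run_gates_Cons apply_Query[OF Cons.prems(1) w] Cons.IH[OF mem ws]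
    by (simp only:)
qed

lemma apply_U:
  assumes "(u, a, b, e) \<in> sys_basis n t"
  shows "apply_op (sys_basis n t) (gate_op n t f R Gate_U) (ket (u, a, b, e)) =
           ket (u, a, xor_bits b (int_bits (t + 2) (2 ^ t - 2 * (\<Sum>i\<in>bitstrings t. of_bool (a i)))), e)"
  unfolding gate_op.simps U_op_def
proof (rule apply_on_register_basis_map)
  show "(u, a, xor_bits b (int_bits (t + 2) (2 ^ t - 2 * (\<Sum>i\<in>bitstrings t. of_bool (a i)))), e)
      \<in> sys_basis n t"
    using assms unfolding sys_basis_def mem_Times_iff fst_conv snd_conv
    by (blast intro: xor_bits_in_bitstrings int_bits_in_bitstrings)
  show "x = y" if "(\<lambda>(u, a, d, e). (a, d)) x = (\<lambda>(u, a, d, e). (a, d)) y"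
    "(\<lambda>(u, a, d, e). (u, e)) x = (\<lambda>(u, a, d, e). (u, e)) y" for x y :: label
    using that by (cases x; cases y) simp
qed (simp_all only: assms finite_sys_basis prod.case)

text \<open>The argument \<open>e\<close> is the output bit. The input bit is 0, so the sign in
  \<open>is_R\<close> is 1.\<close>

definition R_amp :: "nat \<Rightarrow> int \<Rightarrow> bool \<Rightarrow> real" where
  "R_amp t d e = (if e then sqrt (1 - (real_of_int d / 2 ^ t)\<^sup>2) else real_of_int d / 2 ^ t)"

lemma superpos_bool:
  "superpos UNIV k g x = k False * ket (g False) x + k True * ket (g True) x"
  by (simp add: superpos_def UNIV_bool)

lemma apply_R:
  assumes R: "is_R t R" and d: "\<bar>d\<bar> \<le> 2 ^ t"
    and mem: "(u, a, int_bits (t + 2) d, False) \<in> sys_basis n t"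
  shows "apply_op (sys_basis n t) (gate_op n t f R Gate_R) (ket (u, a, int_bits (t + 2) d, False)) =
           superpos UNIV (\<lambda>e. complex_of_real (R_amp t d e)) (\<lambda>e. (u, a, int_bits (t + 2) d, e))"
proof
  fix x :: label
  let ?b = "int_bits (t + 2) d"
  obtain u' a' b' e' where x: "x = (u', a', b', e')" by (cases x)
  have RB: "finite (R_basis t)" "(?b, False) \<in> R_basis t"
    unfolding R_basis_def by auto
  \<comment> \<open>Applying \<open>R\<close> to a ket reads off a column, so the specification of
    \<open>R\<close> fixes the matrix entries needed on the whole system.\<close>
  have "apply_op (R_basis t) R (ket (?b, False)) (b', e') =
      complex_of_real (R_amp t d False) * ket (?b, False) (b', e')
      + complex_of_real (R_amp t d True) * ket (?b, True) (b', e')"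
    using R d unfolding is_R_def R_amp_def by simp
  then have entry: "(b', e') \<in> R_basis t \<Longrightarrow> R (b', e') (?b, False) =
      complex_of_real (R_amp t d False) * ket (?b, False) (b', e')
      + complex_of_real (R_amp t d True) * ket (?b, True) (b', e')"
    unfolding apply_op_ket[OF RB] by simp
  show "apply_op (sys_basis n t) (gate_op n t f R Gate_R) (ket (u, a, ?b, False)) x =
      superpos UNIV (\<lambda>e. complex_of_real (R_amp t d e)) (\<lambda>e. (u, a, ?b, e)) x"
  proof (cases "x \<in> sys_basis n t")
    case True
    then have "(b', e') \<in> R_basis t" by (simp add: x sys_basis_def R_basis_def)
    from entry[OF this] True show ?thesis
      unfolding apply_op_ket[OF finite_sys_basis mem] gate_op.simps on_register_def x prod.case
        superpos_bool
      by (auto simp: ket_def)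
  next
    case False
    \<comment> \<open>Off the system basis \<open>apply_op\<close> returns 0. The superposition does
      too, since changing the last qubit keeps a label inside the basis.\<close>
    have "x \<notin> range (\<lambda>e. (u, a, ?b, e))"
      using False mem by (auto simp: sys_basis_def)
    then show ?thesis
      using False unfolding apply_op_ket[OF finite_sys_basis mem] by (simp add: superpos_outside)
  qed
qed

lemma run_Hadamard_Control:
  assumes mem: "(u, a, d, e) \<in> sys_basis n t"
  shows "run_gates n t f R [Hadamard_Control] (ket (u, a, d, e)) =
           superpos (bitstrings (n - t)) (\<lambda>v. hadamard_n (n - t) v u) (\<lambda>v. (v, a, d, e))"
proof
  fix x :: label
  let ?g = "\<lambda>v. (v, a, d, e)"
  obtain u' a' d' e' where x: "x = (u', a', d', e')" by (cases x)
  have inj: "inj_on ?g (bitstrings (n - t))" by (auto simp: inj_on_def)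
  have entry: "run_gates n t f R [Hadamard_Control] (ket (u, a, d, e)) x =
      (if x \<in> sys_basis n t
       then hadamard_n (n - t) u' u * of_bool ((a', d', e') = (a, d, e)) else 0)"
    unfolding run_gates_Cons run_gates_Nil apply_op_ket[OF finite_sys_basis mem] gate_op.simps
      on_register_def control_def x prod.case ..
  show "run_gates n t f R [Hadamard_Control] (ket (u, a, d, e)) x =
      superpos (bitstrings (n - t)) (\<lambda>v. hadamard_n (n - t) v u) ?g x"
  proof (cases "x \<in> sys_basis n t \<and> (a', d', e') = (a, d, e)")
    case True
    then have "x = ?g u'" "u' \<in> bitstrings (n - t)" by (auto simp: x sys_basis_def)
    then show ?thesis
      using superpos_eval[OF finite_bitstrings inj, of u'] True unfolding entry by simp
  next
    case False
    then have "x \<notin> ?g ` bitstrings (n - t)" using mem by (auto simp: x sys_basis_def)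
    then show ?thesis
      using False unfolding entry superpos_outside[OF \<open>x \<notin> ?g ` bitstrings (n - t)\<close>] by auto
  qed
qed

section \<open>The state before the measurements\<close>

text \<open>This is the number of \<open>w\<close> with \<open>f (u @ w)\<close> false minus the
  number with it true.\<close>

definition discrepancy :: "nat \<Rightarrow> (bool list \<Rightarrow> bool) \<Rightarrow> bool list \<Rightarrow> int" where
  "discrepancy t f u = 2 ^ t - 2 * (\<Sum>w\<in>bitstrings t. of_bool (f (u @ w)))"

text \<open>The bound places the content of \<open>D\<close> in the range where \<open>is_R\<close>
  prescribes the action of \<open>R\<close>.\<close>

lemma abs_discrepancy_le: "\<bar>discrepancy t f u\<bar> \<le> 2 ^ t"
proof -
  have "(\<Sum>w\<in>bitstrings t. of_bool (f (u @ w)) :: int) \<le> (\<Sum>w\<in>bitstrings t. 1)"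
    by (intro sum_mono) auto
  also have "\<dots> = 2 ^ t" by simp
  finally have "(\<Sum>w\<in>bitstrings t. of_bool (f (u @ w)) :: int) \<le> 2 ^ t" .
  moreover have "0 \<le> (\<Sum>w\<in>bitstrings t. of_bool (f (u @ w)) :: int)"
    by (intro sum_nonneg) auto
  ultimately show ?thesis unfolding discrepancy_def by linarith
qed

text \<open>Labels with cleared work registers. The function is restricted because labels in
  \<open>sys_basis\<close> are extensional on \<open>bitstrings t\<close>.\<close>

definition ready :: "nat \<Rightarrow> bool list \<Rightarrow> bool \<Rightarrow> label" where
  "ready t u e = (u, \<lambda>w\<in>bitstrings t. False, replicate (t + 2) False, e)"

lemma ready_in_sys_basis: "u \<in> bitstrings (n - t) \<Longrightarrow> ready t u e \<in> sys_basis n t"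
  unfolding ready_def sys_basis_def by (auto simp del: replicate_Suc)

text \<open>\<open>U\<close> writes the discrepancy into the cleared \<open>D\<close>,
  \<open>R\<close> preserves \<open>D\<close>, and a second XOR with the same string erases it; the
  second round of queries clears the qubits \<open>q_w\<close> likewise. The work registers end
  independent of \<open>u\<close>, which lets different \<open>u\<close> interfere later.\<close>

lemma run_after_Hadamard:
  assumes R: "is_R t R" and u: "u \<in> bitstrings (n - t)"
    and ws: "distinct ws" "set ws = bitstrings t" and ws': "distinct ws'" "set ws' = bitstrings t"
  shows "run_gates n t f R (map Query ws @ [Gate_U, Gate_R, Gate_U] @ map Query ws')
           (ket (ready t u False)) =
         superpos UNIV (\<lambda>e. complex_of_real (R_amp t (discrepancy t f u) e)) (ready t u)"
proof -
  let ?F = "\<lambda>w\<in>bitstrings t. f (u @ w)"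
  let ?z = "replicate (t + 2) False"
  let ?b = "int_bits (t + 2) (discrepancy t f u)"
  have mem: "(u, ?F, b, e) \<in> sys_basis n t" if "b \<in> bitstrings (t + 2)" for b e
    using u that by (auto simp: sys_basis_def)
  have sumF: "2 ^ t - 2 * (\<Sum>i\<in>bitstrings t. of_bool (?F i)) = discrepancy t f u"
    by (simp add: discrepancy_def)
  have b: "?b \<in> bitstrings (t + 2)" by (rule int_bits_in_bitstrings)
  have z: "?z \<in> bitstrings (t + 2)" by (rule replicate_in_bitstrings)
  have Q1: "run_gates n t f R (map Query ws) (ket (ready t u False)) = ket (u, ?F, ?z, False)"
  proof -
    have "(\<lambda>w. if w \<in> set ws then restrict (\<lambda>_. False) (bitstrings t) w \<noteq> f (u @ w)
        else restrict (\<lambda>_. False) (bitstrings t) w) = ?F"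
      using ws by (auto simp: restrict_def)
    then show ?thesis
      using run_Queries[of u "\<lambda>w\<in>bitstrings t. False" ?z False n t ws f R]
        ready_in_sys_basis[OF u, of False] ws
      unfolding ready_def by simp
  qed
  have U1: "run_gates n t f R [Gate_U] (ket (u, ?F, ?z, False)) = ket (u, ?F, ?b, False)"
    unfolding run_gates_Cons run_gates_Nil apply_U[OF mem[OF z]] sumF xor_bits_zero[OF b] ..
  have R1: "run_gates n t f R [Gate_R] (ket (u, ?F, ?b, False)) =
      superpos UNIV (\<lambda>e. complex_of_real (R_amp t (discrepancy t f u) e)) (\<lambda>e. (u, ?F, ?b, e))"
    unfolding run_gates_Cons run_gates_Nil
    by (rule apply_R[OF R abs_discrepancy_le mem[OF b]])
  have U2: "run_gates n t f R [Gate_U] (ket (u, ?F, ?b, e)) = ket (u, ?F, ?z, e)" for e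
    unfolding run_gates_Cons run_gates_Nil apply_U[OF mem[OF b]] sumF xor_bits_self[OF b] ..
  have Q2: "run_gates n t f R (map Query ws') (ket (u, ?F, ?z, e)) = ket (ready t u e)" for e
  proof -
    have "(\<lambda>w. if w \<in> set ws' then ?F w \<noteq> f (u @ w) else ?F w) = (\<lambda>w\<in>bitstrings t. False)"
      using ws' by (auto simp: restrict_def)
    then show ?thesis
      using run_Queries[OF mem[OF z, of e], of ws' f R] ws' unfolding ready_def by simp
  qed
  have "run_gates n t f R (map Query ws @ [Gate_U, Gate_R, Gate_U] @ map Query ws')
         (ket (ready t u False)) =
      run_gates n t f R (map Query ws') (run_gates n t f R [Gate_U] (run_gates n t f R [Gate_R]
        (run_gates n t f R [Gate_U] (run_gates n t f R (map Query ws) (ket (ready t u False))))))"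
    by (simp add: run_gates_append run_gates_Cons run_gates_Nil)
  also have "\<dots> = superpos UNIV (\<lambda>e. complex_of_real (R_amp t (discrepancy t f u) e)) (ready t u)"
    unfolding Q1 U1 R1
    by (subst run_gates_superpos_ket[OF U2], rule run_gates_superpos_ket[OF Q2])
  finally show ?thesis .
qed

lemma run_main_gates:
  assumes "is_R t R"
    and "distinct ws" "set ws = bitstrings t" and "distinct ws'" "set ws' = bitstrings t"
  shows "run_gates n t f R (main_gates ws ws') (ket (zero_label n t)) =
           superpos (bitstrings (n - t) \<times> UNIV)
             (\<lambda>(u, e). complex_of_real (R_amp t (discrepancy t f u) e / sqrt (2 ^ (n - t))))
             (\<lambda>(u, e). ready t u e)"
proof -
  let ?I = "bitstrings (n - t)"
  have zero: "zero_label n t = ready t (replicate (n - t) False) False"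
    by (simp add: zero_label_def ready_def)
  have "run_gates n t f R [Hadamard_Control] (ket (zero_label n t)) =
      superpos ?I (\<lambda>v. hadamard_n (n - t) v (replicate (n - t) False)) (\<lambda>v. ready t v False)"
    unfolding zero
    using run_Hadamard_Control ready_in_sys_basis[of "replicate (n - t) False" n t False]
    unfolding ready_def by simp
  then have "run_gates n t f R (main_gates ws ws') (ket (zero_label n t)) =
      run_gates n t f R (map Query ws @ [Gate_U, Gate_R, Gate_U] @ map Query ws')
        (superpos ?I (\<lambda>v. hadamard_n (n - t) v (replicate (n - t) False)) (\<lambda>v. ready t v False))"
    unfolding main_gates_def by (simp only: run_gates_append)
  also have "\<dots> = superpos (?I \<times> UNIV)
      (\<lambda>(u, e). hadamard_n (n - t) u (replicate (n - t) False) *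
         complex_of_real (R_amp t (discrepancy t f u) e))
      (\<lambda>(u, e). ready t u e)"
    using run_after_Hadamard[OF assms(1) _ assms(2-5)] by (rule run_gates_superpos)
  also have "\<dots> = superpos (?I \<times> UNIV)
      (\<lambda>(u, e). complex_of_real (R_amp t (discrepancy t f u) e / sqrt (2 ^ (n - t))))
      (\<lambda>(u, e). ready t u e)"
    unfolding superpos_def
    by (intro ext sum.cong refl) (auto simp: hadamard_n_zero_right)
  finally show ?thesis .
qed

text \<open>All branches share the same work registers, so transforms of different \<open>u\<close>
  meet in the label \<open>ready t v e\<close> and their amplitudes add.\<close>

lemma run_final_gates:
  "run_gates n t f R final_gates (superpos (bitstrings (n - t)) c (\<lambda>u. ready t u e)) =
     superpos (bitstrings (n - t)) (\<lambda>v. \<Sum>u\<in>bitstrings (n - t). c u * hadamard_n (n - t) v u)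
       (\<lambda>v. ready t v e)"
proof -
  let ?I = "bitstrings (n - t)"
  have "run_gates n t f R [Hadamard_Control] (ket (ready t u e)) =
      superpos ?I (\<lambda>v. hadamard_n (n - t) v u) (\<lambda>v. ready t v e)" if "u \<in> ?I" for u
    using run_Hadamard_Control ready_in_sys_basis[OF that, of e] unfolding ready_def by simp
  then have "run_gates n t f R final_gates (superpos ?I c (\<lambda>u. ready t u e)) =
      superpos (?I \<times> ?I) (\<lambda>(u, v). c u * hadamard_n (n - t) v u) (\<lambda>(u, v). ready t v e)"
    unfolding final_gates_def by (rule run_gates_superpos)
  also have "\<dots> = superpos ?I (\<lambda>v. \<Sum>u\<in>?I. c u * hadamard_n (n - t) v u) (\<lambda>v. ready t v e)"
  proof
    fix x
    have "superpos (?I \<times> ?I) (\<lambda>(u, v). c u * hadamard_n (n - t) v u) (\<lambda>(u, v). ready t v e) x =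
        (\<Sum>u\<in>?I. \<Sum>v\<in>?I. c u * hadamard_n (n - t) v u * ket (ready t v e) x)"
      by (simp add: superpos_def sum.cartesian_product case_prod_beta)
    also have "\<dots> = (\<Sum>v\<in>?I. \<Sum>u\<in>?I. c u * hadamard_n (n - t) v u * ket (ready t v e) x)"
      by (rule sum.swap)
    finally show "superpos (?I \<times> ?I) (\<lambda>(u, v). c u * hadamard_n (n - t) v u) (\<lambda>(u, v). ready t v e) x =
        superpos ?I (\<lambda>v. \<Sum>u\<in>?I. c u * hadamard_n (n - t) v u) (\<lambda>v. ready t v e) x"
      by (simp add: superpos_def sum_distrib_right)
  qed
  finally show ?thesis .
qed

section \<open>The measurements\<close>

text \<open>The bound makes the radicand nonnegative, so squaring undoes
  \<open>sqrt\<close>.\<close>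

lemma R_amp_squares:
  assumes "\<bar>d\<bar> \<le> 2 ^ t"
  shows "(R_amp t d False)\<^sup>2 + (R_amp t d True)\<^sup>2 = 1"
proof -
  have "real_of_int \<bar>d\<bar> \<le> real_of_int (2 ^ t)" using assms by (simp only: of_int_le_iff)
  then have "\<bar>real_of_int d / 2 ^ t\<bar> \<le> 1" by (simp add: field_simps)
  then have "(real_of_int d / 2 ^ t)\<^sup>2 \<le> 1" by (simp add: abs_square_le_1)
  then show ?thesis by (simp add: R_amp_def)
qed

text \<open>Each \<open>v\<close> is carried by the single label \<open>ready t v e\<close>, so its
  Born weight is the squared modulus of its transformed amplitude. Parseval's identity provides the
  unit norm.\<close>

lemma set_measure_control:
  assumes "(\<Sum>u\<in>bitstrings (n - t). (cmod (c u))\<^sup>2) = 1"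
  shows "fst ` set_pmf (measure_register (sys_basis n t) control
             (run_gates n t f R final_gates (superpos (bitstrings (n - t)) c (\<lambda>u. ready t u e)))) =
           {v \<in> bitstrings (n - t). (\<Sum>u\<in>bitstrings (n - t). c u * hadamard_n (n - t) v u) \<noteq> 0}"
proof -
  let ?I = "bitstrings (n - t)"
  let ?k = "\<lambda>v. \<Sum>u\<in>?I. c u * hadamard_n (n - t) v u"
  let ?\<psi> = "superpos ?I ?k (\<lambda>v. ready t v e)"
  have inj: "inj_on (\<lambda>v. ready t v e) ?I" by (auto simp: inj_on_def ready_def)
  have sub: "(\<lambda>v. ready t v e) ` ?I \<subseteq> sys_basis n t" using ready_in_sys_basis by auto
  have "{v \<in> ?I. control (ready t v e) = r} = (if r \<in> ?I then {r} else {})" for r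
    by (auto simp: control_def ready_def)
  then have w: "born_weight (sys_basis n t) control ?\<psi> r = (if r \<in> ?I then (cmod (?k r))\<^sup>2 else 0)" for r
    unfolding born_weight_superpos[OF finite_sys_basis inj sub] by simp
  have "(\<Sum>x\<in>sys_basis n t. (cmod (?\<psi> x))\<^sup>2) = 1"
    unfolding norm_superpos[OF finite_sys_basis inj sub] hadamard_n_norm by (rule assms)
  from set_measure_register[OF finite_sys_basis this, of control] show ?thesis
    unfolding run_final_gates by (auto simp: w image_image split: if_splits)
qed

text \<open>
  The first alternative is outcome 1 of the first measurement. In the second one, \<open>v\<close> is the outcome
  of measuring the control register, whose amplitudes before the last Hadamard transform are
  proportional to the discrepancies.
\<close>
lemma set_procedure:
  assumes "is_R t R"
    and "distinct ws" "set ws = bitstrings t" and "distinct ws'" "set ws' = bitstrings t"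
    and "y \<in> set_pmf (procedure n t f R ws ws')"
  obtains u where "y = Says_Balanced" "u \<in> bitstrings (n - t)" "\<bar>discrepancy t f u\<bar> < 2 ^ t"
  | v where "y = (if v = replicate (n - t) False then Says_Constant else Says_Balanced)"
      "v \<in> bitstrings (n - t)"
      "(\<Sum>u\<in>bitstrings (n - t). of_int (discrepancy t f u) * hadamard_n (n - t) v u) \<noteq> 0"
proof -
  let ?I = "bitstrings (n - t)"
  let ?B = "sys_basis n t"
  let ?A = "\<lambda>u e. R_amp t (discrepancy t f u) e / sqrt (2 ^ (n - t))"
  let ?c = "\<lambda>(u, e). complex_of_real (?A u e)"
  let ?g = "\<lambda>(u, e). ready t u e"
  let ?\<psi> = "superpos (?I \<times> UNIV) ?c ?g"
  let ?w = "born_weight ?B last_qubit ?\<psi>"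
  have inj: "inj_on ?g (?I \<times> UNIV)" by (auto simp: inj_on_def ready_def)
  have sub: "?g ` (?I \<times> UNIV) \<subseteq> ?B" using ready_in_sys_basis by auto
  have slice: "{i \<in> ?I \<times> UNIV. last_qubit (?g i) = r} = (\<lambda>u. (u, r)) ` ?I" for r
    by (auto simp: last_qubit_def ready_def)
  have injp: "inj_on (\<lambda>u. (u, r)) ?I" for r :: bool by (auto simp: inj_on_def)
  have w: "?w r = (\<Sum>u\<in>?I. (?A u r)\<^sup>2)" for r
    unfolding born_weight_superpos[OF finite_sys_basis inj sub] slice
    by (subst sum.reindex[OF injp]) (simp add: norm_divide power_divide)
  have "(\<Sum>x\<in>?B. (cmod (?\<psi> x))\<^sup>2) = (\<Sum>i\<in>?I \<times> UNIV. (cmod (?c i))\<^sup>2)"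
    by (rule norm_superpos[OF finite_sys_basis inj sub])
  also have "\<dots> = (\<Sum>u\<in>?I. \<Sum>e\<in>UNIV. (?A u e)\<^sup>2)"
    by (simp add: sum.cartesian_product case_prod_beta norm_divide power_divide)
  \<comment> \<open>Within each branch the two values of the last qubit share the uniform
    weight.\<close>
  also have "\<dots> = (\<Sum>u\<in>?I. 1 / 2 ^ (n - t))"
    by (intro sum.cong refl)
      (simp add: UNIV_bool power_divide R_amp_squares[OF abs_discrepancy_le] add.commute
        flip: add_divide_distrib)
  also have "\<dots> = 1" by simp
  finally have unit: "(\<Sum>x\<in>?B. (cmod (?\<psi> x))\<^sup>2) = 1" .
  \<comment> \<open>Only outcomes of nonzero weight occur, so the normalisation of the
    post-measurement state is a genuine division.\<close>
  obtain r where r: "?w r \<noteq> 0"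
    and y: "y \<in> set_pmf (if r then return_pmf Says_Balanced
            else map_pmf (\<lambda>(u, _). if u = replicate (n - t) False then Says_Constant else Says_Balanced)
              (measure_register ?B control
                (run_gates n t f R final_gates (post_state ?B last_qubit ?\<psi> r))))"
  proof -
    obtain z where "z \<in> set_pmf (measure_register ?B last_qubit ?\<psi>)"
      and y: "y \<in> set_pmf ((\<lambda>(r, \<psi>). if r then return_pmf Says_Balanced
            else map_pmf (\<lambda>(u, _). if u = replicate (n - t) False then Says_Constant else Says_Balanced)
              (measure_register ?B control (run_gates n t f R final_gates \<psi>))) z)"
      using assms(6) unfolding procedure_def run_main_gates[OF assms(1-5)] set_bind_pmf by blast
    then obtain r where "?w r \<noteq> 0" "z = (r, post_state ?B last_qubit ?\<psi> r)"
      unfolding set_measure_register[OF finite_sys_basis unit] by blast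
    with y show thesis by (intro that[of r]) (simp_all only: prod.case simp_thms)
  qed
  show thesis
  proof (cases r)
    case True
    from r obtain u where u: "u \<in> ?I" "(?A u r)\<^sup>2 \<noteq> 0"
      unfolding w by (rule sum.not_neutral_contains_not_neutral)
    \<comment> \<open>At absolute value \<open>2 ^ t\<close> the amplitude of outcome 1 is
      \<open>sqrt 0\<close>, against the choice of \<open>u\<close>.\<close>
    have "\<bar>discrepancy t f u\<bar> \<noteq> 2 ^ t"
    proof
      assume "\<bar>discrepancy t f u\<bar> = 2 ^ t"
      then have "\<bar>real_of_int (discrepancy t f u)\<bar> = 2 ^ t"
        using arg_cong[of "\<bar>discrepancy t f u\<bar>" "2 ^ t" real_of_int]
        unfolding of_int_abs of_int_power of_int_numeral by blast
      then have "\<bar>real_of_int (discrepancy t f u) / 2 ^ t\<bar> = 1"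
        by simp
      then have "(real_of_int (discrepancy t f u) / 2 ^ t)\<^sup>2 = 1"
        using power2_abs[of "real_of_int (discrepancy t f u) / 2 ^ t"] by (simp only: power_one)
      with u True show False by (simp add: R_amp_def)
    qed
    then have "\<bar>discrepancy t f u\<bar> < 2 ^ t" using abs_discrepancy_le[of t f u] by simp
    moreover have "y = Says_Balanced" using y unfolding if_P[OF True] by simp
    ultimately show thesis using u(1) that(1) by blast
  next
    case False
    define s where "s = complex_of_real (sqrt (?w False))"
    have wF: "?w False > 0"
      using r False unfolding w by (simp add: less_le sum_nonneg)
    let ?c' = "\<lambda>u. ?c (u, False) / s"
    have "post_state ?B last_qubit ?\<psi> False =
        superpos ((\<lambda>u. (u, False)) ` ?I) (\<lambda>i. ?c i / s) ?g"
      unfolding s_def slice[symmetric] by (rule post_state_superpos) simp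
    also have "\<dots> = superpos ?I ?c' (\<lambda>u. ready t u False)"
      unfolding superpos_def by (simp add: sum.reindex[OF injp])
    finally have post: "post_state ?B last_qubit ?\<psi> False = superpos ?I ?c' (\<lambda>u. ready t u False)" .
    have s2: "(cmod s)\<^sup>2 = ?w False"
      using less_imp_le[OF wF] unfolding s_def norm_of_real power2_abs by (rule real_sqrt_pow2)
    have "(cmod (?c' u))\<^sup>2 = (?A u False)\<^sup>2 / ?w False" for u
      by (simp only: prod.case norm_divide power_divide s2 norm_of_real power2_abs)
    then have "(\<Sum>u\<in>?I. (cmod (?c' u))\<^sup>2) = (\<Sum>u\<in>?I. (?A u False)\<^sup>2) / ?w False"
      by (simp only: sum_divide_distrib)
    also have "\<dots> = 1" using wF by (simp only: w[symmetric]) simp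
    finally have unit': "(\<Sum>u\<in>?I. (cmod (?c' u))\<^sup>2) = 1" .
    have "y \<in> (\<lambda>(u, _). if u = replicate (n - t) False then Says_Constant else Says_Balanced) `
        set_pmf (measure_register ?B control (run_gates n t f R final_gates
          (superpos ?I ?c' (\<lambda>u. ready t u False))))"
      using y False by (simp only: post if_False set_map_pmf)
    then obtain z where z: "z \<in> set_pmf (measure_register ?B control (run_gates n t f R final_gates
          (superpos ?I ?c' (\<lambda>u. ready t u False))))"
      and yz: "y = (\<lambda>(u, _). if u = replicate (n - t) False then Says_Constant else Says_Balanced) z"
      by (rule imageE)
    define v where "v = fst z"
    have yv: "y = (if v = replicate (n - t) False then Says_Constant else Says_Balanced)"
      unfolding yz v_def case_prod_beta ..
    have v: "v \<in> fst ` set_pmf (measure_register ?B control (run_gates n t f R final_gates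
          (superpos ?I ?c' (\<lambda>u. ready t u False))))"
      using z unfolding v_def by (rule imageI)
    have v': "v \<in> ?I" "(\<Sum>u\<in>?I. ?c' u * hadamard_n (n - t) v u) \<noteq> 0"
      using v unfolding set_measure_control[OF unit'] by auto
    \<comment> \<open>Apart from the discrepancy and the Hadamard entry, all factors are independent
      of \<open>u\<close> and can be pulled out; only nonvanishing is at stake.\<close>
    have "(\<Sum>u\<in>?I. ?c' u * hadamard_n (n - t) v u) =
        (\<Sum>u\<in>?I. of_int (discrepancy t f u) * hadamard_n (n - t) v u) /
          (2 ^ t * complex_of_real (sqrt (2 ^ (n - t))) * s)"
      unfolding sum_divide_distrib by (intro sum.cong refl) (simp add: R_amp_def)
    with v'(2) have "(\<Sum>u\<in>?I. of_int (discrepancy t f u) * hadamard_n (n - t) v u) \<noteq> 0"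
      by (metis div_0)
    then show thesis by (rule that(2)[OF yv v'(1)])
  qed
qed

section \<open>Discrepancies of constant and balanced functions, and the verdicts\<close>

text \<open>Value 0 throughout gives sign 1 and value 1 throughout gives sign -1. The sign is common
  to all \<open>u\<close>, hence a global phase.\<close>

lemma discrepancy_constant:
  assumes "t \<le> n" "constant_fun n f"
  obtains \<sigma> :: int where "\<bar>\<sigma>\<bar> = 1" "\<forall>u\<in>bitstrings (n - t). discrepancy t f u = \<sigma> * 2 ^ t"
proof -
  have app: "u @ w \<in> bitstrings n" if "u \<in> bitstrings (n - t)" "w \<in> bitstrings t" for u w
    using that assms by (simp add: bitstrings_def)
  from assms(2) consider "\<forall>x\<in>bitstrings n. \<not> f x" | "\<forall>x\<in>bitstrings n. f x"
    by (auto simp: constant_fun_def)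
  then show thesis
  proof cases
    case 1
    then show thesis by (intro that[of 1]) (simp_all add: discrepancy_def app)
  next
    case 2
    then show thesis by (intro that[of "-1"]) (simp_all add: discrepancy_def app)
  qed
qed

text \<open>Joining \<open>u\<close> and \<open>w\<close> into one string turns the sum into the
  number of zeros minus the number of ones of \<open>f\<close> on all \<open>n\<close>-bit
  strings.\<close>

lemma sum_discrepancy_balanced:
  assumes "1 \<le> n" "t \<le> n" "balanced_fun n f"
  shows "(\<Sum>u\<in>bitstrings (n - t). discrepancy t f u) = 0"
proof -
  have "{x \<in> bitstrings n. f x = True} = bitstrings n \<inter> {x. f x}" by auto
  then have "(\<Sum>x\<in>bitstrings n. of_bool (f x) :: int) = 2 ^ (n - 1)"
    using assms(3) by (simp add: balanced_fun_def sum_of_bool_eq)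
  moreover have "(\<Sum>u\<in>bitstrings (n - t). discrepancy t f u) =
      2 ^ (n - t) * 2 ^ t - 2 * (\<Sum>x\<in>bitstrings n. of_bool (f x))"
    unfolding discrepancy_def sum_subtractf sum_distrib_left[symmetric]
      sum_bitstrings_append[OF assms(2), of "\<lambda>x. of_bool (f x)"] by simp
  \<comment> \<open>Subtraction on \<open>nat\<close> is truncated: at \<open>n = 0\<close> the
    sides would be 1 and 2.\<close>
  moreover have "(2::int) ^ (n - t) * 2 ^ t = 2 * 2 ^ (n - 1)"
    using assms(1,2) by (simp flip: power_add power_Suc)
  ultimately show ?thesis by simp
qed

text \<open>The zero column is constant, so up to that constant the sum is the inner product of the
  columns \<open>v\<close> and zero.\<close>

lemma hadamard_n_sum:
  assumes "v \<in> bitstrings m" "v \<noteq> replicate m False"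
  shows "(\<Sum>u\<in>bitstrings m. hadamard_n m v u) = 0"
proof -
  have "(\<Sum>u\<in>bitstrings m. hadamard_n m v u) * complex_of_real (1 / sqrt (2 ^ m)) =
      (\<Sum>u\<in>bitstrings m. cnj (hadamard_n m u v) * hadamard_n m u (replicate m False))"
    unfolding sum_distrib_right by (intro sum.cong refl) (simp only: hadamard_n_zero_right hadamard_n_hermitian[of m v])
  also have "\<dots> = 0"
    using hadamard_n_orthonormal[OF assms(1) replicate_in_bitstrings] assms(2) by simp
  finally show ?thesis by simp
qed

text \<open>Exactness thereby reduces to the description of possible verdicts in
  \<open>set_procedure\<close>.\<close>

lemma pmf_eq_1_if_set_pmf: "(\<And>y. y \<in> set_pmf p \<Longrightarrow> y = v) \<Longrightarrow> pmf p v = 1"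
  using set_pmf_subset_singleton[of p v] by auto

lemma count_list_map_Query:
  "distinct ws \<Longrightarrow> count_list (map Query ws) (Query w) = of_bool (w \<in> set ws)"
  by (induction ws) auto

theorem mainTheorem5:
  fixes n t :: nat
    and f :: "bool list \<Rightarrow> bool"
    and R :: "(bool list \<times> bool) operator"
    and ws ws' :: "bool list list"
  assumes "1 \<le> t" and "t \<le> n"
    and "constant_fun n f \<or> balanced_fun n f"
    and "is_R t R"
    and "distinct ws" and "set ws = bitstrings t"
    and "distinct ws'" and "set ws' = bitstrings t"
  shows "(\<forall>w\<in>bitstrings t. count_list (main_gates ws ws') (Query w) = 2 \<and>
                           count_list final_gates (Query w) = 0) \<and>
         (constant_fun n f \<longrightarrow> pmf (procedure n t f R ws ws') Says_Constant = 1) \<and>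
         (balanced_fun n f \<longrightarrow> pmf (procedure n t f R ws ws') Says_Balanced = 1)"
proof (intro conjI impI ballI)
  fix w assume "w \<in> bitstrings t"
  then show "count_list (main_gates ws ws') (Query w) = 2"
    using assms by (simp add: main_gates_def count_list_map_Query)
  show "count_list final_gates (Query w) = 0"
    by (simp add: final_gates_def)
next
  assume "constant_fun n f"
  with assms(2) obtain \<sigma> :: int where \<sigma>: "\<bar>\<sigma>\<bar> = 1"
    "\<forall>u\<in>bitstrings (n - t). discrepancy t f u = \<sigma> * 2 ^ t"
    by (rule discrepancy_constant)
  show "pmf (procedure n t f R ws ws') Says_Constant = 1"
  proof (rule pmf_eq_1_if_set_pmf)
    fix y assume "y \<in> set_pmf (procedure n t f R ws ws')"
    with assms(4-8) show "y = Says_Constant"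
    proof (cases rule: set_procedure)
      case (1 u)
      then show ?thesis using \<sigma> by (simp add: abs_mult)
    next
      case (2 v)
      have "(\<Sum>u\<in>bitstrings (n - t). of_int (discrepancy t f u) * hadamard_n (n - t) v u) =
          of_int \<sigma> * 2 ^ t * (\<Sum>u\<in>bitstrings (n - t). hadamard_n (n - t) v u)"
        unfolding sum_distrib_left by (intro sum.cong refl) (simp add: \<sigma>)
      \<comment> \<open>A nonzero string \<open>v\<close> would have row sum 0, against the nonzero
        amplitude.\<close>
      with 2 show ?thesis using hadamard_n_sum by fastforce
    qed
  qed
next
  assume bal: "balanced_fun n f"
  show "pmf (procedure n t f R ws ws') Says_Balanced = 1"
  proof (rule pmf_eq_1_if_set_pmf)
    fix y assume "y \<in> set_pmf (procedure n t f R ws ws')"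
    with assms(4-8) show "y = Says_Balanced"
    \<comment> \<open>Outcome 1 already gives the right verdict, so only outcome 0 needs an
      argument.\<close>
    proof (cases rule: set_procedure)
      case (2 v)
      have "v \<noteq> replicate (n - t) False"
      proof
        assume "v = replicate (n - t) False"
        then have "(\<Sum>u\<in>bitstrings (n - t). of_int (discrepancy t f u) * hadamard_n (n - t) v u) =
            of_int (\<Sum>u\<in>bitstrings (n - t). discrepancy t f u) * complex_of_real (1 / sqrt (2 ^ (n - t)))"
          unfolding of_int_sum sum_distrib_right
          by (intro sum.cong refl)
            (simp add: hadamard_n_hermitian[of _ "replicate (n - t) False"] hadamard_n_zero_right)
        with 2(3) show False
          using sum_discrepancy_balanced[OF _ assms(2) bal] assms(1,2) by simp
      qed
      with 2(1) show ?thesis by simp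
    qed
  qed
qed

end
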